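(* Let $(A,\tau)$ be a symmetric Frobenius algebra over a field $k$. Then for all $a,b\in A$ $$\langle a,b\rangle_\tau=\langle a,b^\vee\rangle,$$ that is, $$\sum_{k,l}\tau(a\phi'_k)\,\tau(b\phi'_l)\,\tau(\phi''_k\phi''_l)\,\tau(\phi'''_k\phi'''_l)=\mathrm{tr}_A\bigl(L(a)R(b)\bigr),$$ where $\Phi=\sum_k\phi'_k\otimes\phi''_k\otimes\phi'''_k\in A\otimes A\otimes A$ is the unique element with $\tau(abc)=\sum_k\tau(a\phi'_k)\tau(b\phi''_k)\tau(c\phi'''_k)$ for all $a,b,c\in A$, and $L(a):c\mapsto ac$, $R(b):c\mapsto cb$ are the operators of left and right multiplication in $A$. Equivalently, $$\sum_i\tau(a\gamma'_ib\gamma''_i)=\mathrm{tr}_A(L(a)R(b)),$$ where $\gamma=\sum_i\gamma'_i\otimes\gamma''_i\in A\otimes A$ is the unique symmetric element with $a=\sum_i\gamma'_i\tau(\gamma''_ia)=\sum_i\tau(a\gamma'_i)\gamma''_i$ for all $a\in A$.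
   Context: A symmetric Frobenius algebra $(A,\tau)$ is a finite dimensional unital associative $k$-algebra $A$ with a linear functional $\tau:A\to k$ such that $\tau(ab)=\tau(ba)$ and the bilinear form $(a,b)\mapsto\tau(ab)$ is non-degenerate. The pairing $\langle a,b\rangle_\tau$ on (classes in $\mathsf{HH}_0(A)=A/[A,A]$ of) elements of $A$ is the one coming from the associated topological field theory; by the graph description of Kontsevich–Soibelman it is given by the formula $\langle a,b\rangle_\tau=\sum_{k,l}\tau(a\phi'_k)\tau(b\phi'_l)\tau(\phi''_k\phi''_l)\tau(\phi'''_k\phi'''_l)$, which is to be taken as its definition. The pairing $\langle\,,\,\rangle:\mathsf{HH}_0(A)\times\mathsf{HH}_0(A^{\mathsf{op}})\to k$ is given, for a finite dimensional associative algebra, by $\langle a,b\rangle=\mathrm{tr}_A(L(a)R(b))$, and $\,^\vee:A/[A,A]\to A^{\mathsf{op}}/[A^{\mathsf{op}},A^{\mathsf{op}}]$ is induced by the identity map of the vector space $A$. *)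

theory Defs
  imports Complex_Main "HOL-Library.Poly_Mapping"
begin

(* The sort {ring, monoid_mult} is that of unital associative rings; unlike ring_1 it does not
   exclude the zero ring. Finite dimensionality is witnessed by the arbitrary finite basis B. *)
locale finite_dimensional_algebra = finite_dimensional_vector_space scale B
  for scale :: "'k::field \<Rightarrow> 'a::{ring, monoid_mult} \<Rightarrow> 'a" and B :: "'a set" +
  assumes scale_mult_left: "scale c x * y = scale c (x * y)"
    and scale_mult_right: "x * scale c y = scale c (x * y)"

definition nondegenerate :: "('a::zero \<Rightarrow> 'a \<Rightarrow> 'k::zero) \<Rightarrow> bool" where
  "nondegenerate \<beta> \<longleftrightarrow>
     (\<forall>x. (\<forall>y. \<beta> x y = 0) \<longrightarrow> x = 0) \<and> (\<forall>y. (\<forall>x. \<beta> x y = 0) \<longrightarrow> y = 0)"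

locale symmetric_frobenius_algebra = finite_dimensional_algebra scale B
  for scale :: "'k::field \<Rightarrow> 'a::{ring, monoid_mult} \<Rightarrow> 'a" and B :: "'a set" +
  fixes \<tau> :: "'a \<Rightarrow> 'k"
  assumes linear_form: "Vector_Spaces.linear scale (*) \<tau>"
    and symmetric_form: "\<tau> (x * y) = \<tau> (y * x)"
    and nondegenerate_form: "nondegenerate (\<lambda>x y. \<tau> (x * y))"

(* The tensor powers of A with two and three factors: the free vector space on pairs (triples),
   modulo the subspace spanned by the multilinearity relations. Tensors are cosets. *)

definition free_scale :: "'k::field \<Rightarrow> ('g \<Rightarrow>\<^sub>0 'k) \<Rightarrow> ('g \<Rightarrow>\<^sub>0 'k)" where
  "free_scale c F = Poly_Mapping.map ((*) c) F"

abbreviation gen :: "'g \<Rightarrow> ('g \<Rightarrow>\<^sub>0 'k::field)" where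
  "gen g \<equiv> Poly_Mapping.single g 1"

definition relations2 ::
  "('k::field \<Rightarrow> 'a::ab_group_add \<Rightarrow> 'a) \<Rightarrow> (('a \<times> 'a) \<Rightarrow>\<^sub>0 'k) set" where
  "relations2 scale =
     {gen (x + x', y) - gen (x, y) - gen (x', y) | x x' y. True} \<union>
     {gen (x, y + y') - gen (x, y) - gen (x, y') | x y y'. True} \<union>
     {gen (scale c x, y) - free_scale c (gen (x, y)) | c x y. True} \<union>
     {gen (x, scale c y) - free_scale c (gen (x, y)) | c x y. True}"

definition relations3 ::
  "('k::field \<Rightarrow> 'a::ab_group_add \<Rightarrow> 'a) \<Rightarrow> (('a \<times> 'a \<times> 'a) \<Rightarrow>\<^sub>0 'k) set" where
  "relations3 scale =
     {gen (x + x', y, z) - gen (x, y, z) - gen (x', y, z) | x x' y z. True} \<union>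
     {gen (x, y + y', z) - gen (x, y, z) - gen (x, y', z) | x y y' z. True} \<union>
     {gen (x, y, z + z') - gen (x, y, z) - gen (x, y, z') | x y z z'. True} \<union>
     {gen (scale c x, y, z) - free_scale c (gen (x, y, z)) | c x y z. True} \<union>
     {gen (x, scale c y, z) - free_scale c (gen (x, y, z)) | c x y z. True} \<union>
     {gen (x, y, scale c z) - free_scale c (gen (x, y, z)) | c x y z. True}"

(* tensor2 scale n x y is the sum over i < n of the pure tensors of x i and y i, and likewise for
   tensor3. Every coset has this form, as scalars can be absorbed into the first factor. *)

definition tensor2 ::
  "('k::field \<Rightarrow> 'a::ab_group_add \<Rightarrow> 'a) \<Rightarrow> nat \<Rightarrow> (nat \<Rightarrow> 'a) \<Rightarrow> (nat \<Rightarrow> 'a) \<Rightarrow>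
    (('a \<times> 'a) \<Rightarrow>\<^sub>0 'k) set" where
  "tensor2 scale n x y =
     {F. F - (\<Sum>i<n. gen (x i, y i)) \<in> module.span free_scale (relations2 scale)}"

definition tensor3 ::
  "('k::field \<Rightarrow> 'a::ab_group_add \<Rightarrow> 'a) \<Rightarrow> nat \<Rightarrow> (nat \<Rightarrow> 'a) \<Rightarrow> (nat \<Rightarrow> 'a) \<Rightarrow>
    (nat \<Rightarrow> 'a) \<Rightarrow> (('a \<times> 'a \<times> 'a) \<Rightarrow>\<^sub>0 'k) set" where
  "tensor3 scale n x y z =
     {F. F - (\<Sum>i<n. gen (x i, y i, z i)) \<in> module.span free_scale (relations3 scale)}"

(* The identities below depend only on the tensor, not on the chosen presentation. *)

definition is_Phi ::
  "('k::field \<Rightarrow> 'a::{ring, monoid_mult} \<Rightarrow> 'a) \<Rightarrow> ('a \<Rightarrow> 'k) \<Rightarrow>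
    (('a \<times> 'a \<times> 'a) \<Rightarrow>\<^sub>0 'k) set \<Rightarrow> bool" where
  "is_Phi scale \<tau> \<Phi> \<longleftrightarrow>
     (\<exists>n p q r. \<Phi> = tensor3 scale n p q r \<and>
        (\<forall>a b c. \<tau> (a * b * c) = (\<Sum>k<n. \<tau> (a * p k) * \<tau> (b * q k) * \<tau> (c * r k))))"

definition is_gamma ::
  "('k::field \<Rightarrow> 'a::{ring, monoid_mult} \<Rightarrow> 'a) \<Rightarrow> ('a \<Rightarrow> 'k) \<Rightarrow>
    (('a \<times> 'a) \<Rightarrow>\<^sub>0 'k) set \<Rightarrow> bool" where
  "is_gamma scale \<tau> \<gamma> \<longleftrightarrow>
     (\<exists>n g h. \<gamma> = tensor2 scale n g h \<and> tensor2 scale n g h = tensor2 scale n h g \<and>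
        (\<forall>a. a = (\<Sum>i<n. scale (\<tau> (h i * a)) (g i)) \<and>
             a = (\<Sum>i<n. scale (\<tau> (a * g i)) (h i))))"

(* HH_0 of the algebra with multiplication m; the parameter m allows for the opposite algebra. *)

definition commutator_space ::
  "('k::field \<Rightarrow> 'a::ab_group_add \<Rightarrow> 'a) \<Rightarrow> ('a \<Rightarrow> 'a \<Rightarrow> 'a) \<Rightarrow> 'a set" where
  "commutator_space scale m = module.span scale {m x y - m y x | x y. True}"

definition HH0_class ::
  "('k::field \<Rightarrow> 'a::ab_group_add \<Rightarrow> 'a) \<Rightarrow> ('a \<Rightarrow> 'a \<Rightarrow> 'a) \<Rightarrow> 'a \<Rightarrow> 'a set" where
  "HH0_class scale m a = {x. x - a \<in> commutator_space scale m}"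

definition op_mult :: "'a::times \<Rightarrow> 'a \<Rightarrow> 'a" where
  "op_mult x y = y * x"

(* Maps on quotients are given by the common value on all representatives. *)

definition vee ::
  "('k::field \<Rightarrow> 'a::{ring, monoid_mult} \<Rightarrow> 'a) \<Rightarrow> 'a set \<Rightarrow> 'a set" where
  "vee scale X = the_elem {HH0_class scale op_mult (id x) | x. x \<in> X}"

definition L :: "'a::times \<Rightarrow> 'a \<Rightarrow> 'a" where "L a c = a * c"

definition R :: "'a::times \<Rightarrow> 'a \<Rightarrow> 'a" where "R b c = c * b"

(* Trace of a linear operator, computed in the basis B. *)
definition operator_trace ::
  "('k::field \<Rightarrow> 'a::ab_group_add \<Rightarrow> 'a) \<Rightarrow> 'a set \<Rightarrow> ('a \<Rightarrow> 'a) \<Rightarrow> 'k" where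
  "operator_trace scale B f = (\<Sum>e\<in>B. module.representation scale B (f e) e)"

definition HH0_pairing ::
  "('k::field \<Rightarrow> 'a::{ring, monoid_mult} \<Rightarrow> 'a) \<Rightarrow> 'a set \<Rightarrow> 'a set \<Rightarrow> 'a set \<Rightarrow> 'k" where
  "HH0_pairing scale B X Y =
     the_elem {operator_trace scale B (L a \<circ> R b) | a b. a \<in> X \<and> b \<in> Y}"

definition TFT_pairing ::
  "('k::field \<Rightarrow> 'a::{ring, monoid_mult} \<Rightarrow> 'a) \<Rightarrow> ('a \<Rightarrow> 'k) \<Rightarrow> 'a set \<Rightarrow> 'a set \<Rightarrow> 'k" where
  "TFT_pairing scale \<tau> X Y =
     the_elem {(\<Sum>k<n. \<Sum>l<n. \<tau> (a * p k) * \<tau> (b * p l) * \<tau> (q k * q l) * \<tau> (r k * r l)) |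
               n p q r a b. is_Phi scale \<tau> (tensor3 scale n p q r) \<and> a \<in> X \<and> b \<in> Y}"

end

(* A basis e with \<tau>-dual basis d gives \<gamma> = \<Sum> e \<otimes> d and \<Phi> = \<Sum> e f \<otimes> d\<^sub>e \<otimes> d\<^sub>f, and the e-coordinate of
   x is \<tau> (x d\<^sub>e), so the trace of L a R b is \<Sum> \<tau> (a e b d\<^sub>e). Linear functionals on the free vector
   space that kill the relations separate tensors, and every linear functional on A is \<tau> (u _);
   hence a tensor is determined by its pairings with \<tau>, which gives uniqueness and lets every
   multilinear expression in \<gamma> be computed on the dual bases. Inserting \<tau> (x y) =
   \<Sum> \<tau> (e x) \<tau> (d\<^sub>e y) for both \<tau> (\<phi>'' \<phi>'') and \<tau> (\<phi>''' \<phi>''') collapses the sum over \<Phi> \<otimes> \<Phi> to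
   \<Sum> \<tau> (a e f) \<tau> (b d\<^sub>e d\<^sub>f) = \<Sum> \<tau> (a e b d\<^sub>e). *)

theory Submission
  imports Defs
begin

section \<open>Linear functionals on the free vector space\<close>

lemma free_scale_lookup: "Poly_Mapping.lookup (free_scale c F) g = c * Poly_Mapping.lookup F g"
  unfolding free_scale_def by transfer (auto simp: when_def)

lemma vector_space_free_scale: "vector_space (free_scale :: 'k::field \<Rightarrow> ('g \<Rightarrow>\<^sub>0 'k) \<Rightarrow> _)"
  by unfold_locales
    (auto intro!: poly_mapping_eqI simp: free_scale_lookup lookup_add algebra_simps)

lemma vector_space_field: "vector_space ((*) :: 'k::field \<Rightarrow> 'k \<Rightarrow> 'k)"
  by unfold_locales (auto simp: algebra_simps)

definition free_extension :: "('g \<Rightarrow> 'k::field) \<Rightarrow> ('g \<Rightarrow>\<^sub>0 'k) \<Rightarrow> 'k" where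
  "free_extension \<beta> F = (\<Sum>g\<in>Poly_Mapping.keys F. Poly_Mapping.lookup F g * \<beta> g)"

text \<open>Indices outside the support have coefficient 0. The freedom in \<open>S\<close> lets
  additivity be proved over one common index set, since cancellation can shrink the support of
  \<open>F + G\<close>.\<close>

lemma free_extension_eq:
  assumes "finite S" "Poly_Mapping.keys F \<subseteq> S"
  shows "free_extension \<beta> F = (\<Sum>g\<in>S. Poly_Mapping.lookup F g * \<beta> g)"
  unfolding free_extension_def using assms
  by (intro sum.mono_neutral_left) (auto simp: in_keys_iff)

lemma linear_free_extension:
  fixes \<beta> :: "'g \<Rightarrow> 'k::field"
  shows "Vector_Spaces.linear free_scale (*) (free_extension \<beta>)"
  unfolding Vector_Spaces.linear_iff
proof (intro conjI allI)
  fix F G :: "'g \<Rightarrow>\<^sub>0 'k" and c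
  let ?S = "Poly_Mapping.keys F \<union> Poly_Mapping.keys G"
  have "finite ?S" "Poly_Mapping.keys (F + G) \<subseteq> ?S"
    by (simp_all add: keys_add)
  then show "free_extension \<beta> (F + G) = free_extension \<beta> F + free_extension \<beta> G"
    by (simp add: free_extension_eq[of ?S] lookup_add distrib_right sum.distrib)
  have "Poly_Mapping.keys (free_scale c F) \<subseteq> Poly_Mapping.keys F"
    by (auto simp: in_keys_iff free_scale_lookup)
  then show "free_extension \<beta> (free_scale c F) = c * free_extension \<beta> F"
    by (simp add: free_extension_eq[of "Poly_Mapping.keys F"] free_scale_lookup
        sum_distrib_left mult.assoc)
qed (rule vector_space_free_scale vector_space_field)+

lemma free_extension_gen [simp]: "free_extension \<beta> (gen g) = \<beta> g"
  by (simp add: free_extension_def)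

text \<open>A vector outside \<open>span S\<close> is separated from it by a functional: a maximal
  independent \<open>C\<close> inside \<open>S\<close> stays independent when \<open>u\<close> is
  added, so values 0 on \<open>C\<close> and 1 on \<open>u\<close> extend linearly.\<close>

lemma (in vector_space) in_span_if_functionals_vanish:
  assumes "\<And>\<phi>. Vector_Spaces.linear scale (*) \<phi> \<Longrightarrow> (\<And>s. s \<in> S \<Longrightarrow> \<phi> s = 0) \<Longrightarrow> \<phi> u = 0"
  shows "u \<in> span S"
proof (rule ccontr)
  assume u: "u \<notin> span S"
  interpret pair: vector_space_pair scale "(*)"
    by (intro vector_space_pair.intro vector_space_axioms vector_space_field)
  obtain C where C: "C \<subseteq> S" "independent C" "S \<subseteq> span C"
    by (rule maximal_independent_subset)
  then have "u \<notin> span C"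
    using u span_mono by blast
  then have "independent (insert u C)"
    using C by (simp add: independent_insertI)
  then obtain \<phi> where \<phi>: "Vector_Spaces.linear scale (*) \<phi>"
    "\<forall>x\<in>insert u C. \<phi> x = (if x = u then 1 else 0)"
    using pair.linear_independent_extend[of "insert u C" "\<lambda>x. if x = u then 1 else 0"] by blast
  have "\<phi> c = 0" if "c \<in> C" for c
    using \<phi>(2) that \<open>u \<notin> span C\<close> span_base by auto
  then have "\<phi> s = 0" if "s \<in> S" for s
    using pair.linear_eq_0_on_span[OF \<phi>(1)] C(3) that by blast
  then have "\<phi> u = 0"
    using assms \<phi>(1) by blast
  then show False
    using \<phi>(2) by simp
qed

lemma (in vector_space) functional_vanishes_on_span:
  assumes "Vector_Spaces.linear scale (*) \<phi>" "\<And>s. s \<in> S \<Longrightarrow> \<phi> s = 0" "u \<in> span S"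
  shows "\<phi> u = 0"
  using vector_space_pair.linear_eq_0_on_span[OF
      vector_space_pair.intro[OF vector_space_axioms vector_space_field]] assms by blast

text \<open>Serves both kinds of quotient used here, tensors and classes in
  \<open>HH_0\<close>.\<close>

lemma (in module) coset_eq_iff:
  "{F. F - u \<in> span S} = {F. F - v \<in> span S} \<longleftrightarrow> u - v \<in> span S"
proof
  assume "{F. F - u \<in> span S} = {F. F - v \<in> span S}"
  moreover have "u \<in> {F. F - u \<in> span S}"
    by (simp add: span_zero)
  ultimately show "u - v \<in> span S"
    by blast
next
  assume uv: "u - v \<in> span S"
  have "F - u \<in> span S \<longleftrightarrow> F - v \<in> span S" for F
    using span_add[OF _ uv, of "F - u"] span_diff[OF _ uv, of "F - v"] by auto
  then show "{F. F - u \<in> span S} = {F. F - v \<in> span S}"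
    by simp
qed

lemma linear_functional_sum:
  assumes "Vector_Spaces.linear s (*) \<phi>"
  shows "\<phi> (\<Sum>i\<in>I. f i) = (\<Sum>i\<in>I. \<phi> (f i))"
proof -
  interpret Vector_Spaces.linear s "(*)" \<phi> by fact
  show ?thesis by (rule sum)
qed

lemma linear_functional_add:
  assumes "Vector_Spaces.linear s (*) \<phi>"
  shows "\<phi> (x + y) = \<phi> x + \<phi> y"
  using assms by (simp add: Vector_Spaces.linear_iff)

lemma linear_functional_scale:
  assumes "Vector_Spaces.linear s (*) \<phi>"
  shows "\<phi> (s c x) = c * \<phi> x"
  using assms by (simp add: Vector_Spaces.linear_iff)

lemma linear_functional_diff:
  assumes "Vector_Spaces.linear s (*) \<phi>"
  shows "\<phi> (x - y) = \<phi> x - \<phi> y"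
proof -
  interpret Vector_Spaces.linear s "(*)" \<phi> by fact
  show ?thesis by (rule diff)
qed

section \<open>Equality of tensors\<close>

lemma relations2_intros:
  "gen (x + x', y) - gen (x, y) - gen (x', y) \<in> relations2 scale"
  "gen (x, y + y') - gen (x, y) - gen (x, y') \<in> relations2 scale"
  "gen (scale c x, y) - free_scale c (gen (x, y)) \<in> relations2 scale"
  "gen (x, scale c y) - free_scale c (gen (x, y)) \<in> relations2 scale"
  unfolding relations2_def Un_iff mem_Collect_eq by metis+

lemma relations3_intros:
  "gen (x + x', y, z) - gen (x, y, z) - gen (x', y, z) \<in> relations3 scale"
  "gen (x, y + y', z) - gen (x, y, z) - gen (x, y', z) \<in> relations3 scale"
  "gen (x, y, z + z') - gen (x, y, z) - gen (x, y, z') \<in> relations3 scale"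
  "gen (scale c x, y, z) - free_scale c (gen (x, y, z)) \<in> relations3 scale"
  "gen (x, scale c y, z) - free_scale c (gen (x, y, z)) \<in> relations3 scale"
  "gen (x, y, scale c z) - free_scale c (gen (x, y, z)) \<in> relations3 scale"
  unfolding relations3_def Un_iff mem_Collect_eq by metis+

text \<open>Bilinear forms factor through the tensor product: the linear extension of
  \<open>\<beta>\<close> from the generators kills every bilinearity relation, hence their
  span.\<close>

lemma tensor2_eqD:
  fixes scale :: "'k::field \<Rightarrow> 'a::ab_group_add \<Rightarrow> 'a"
  assumes eq: "tensor2 scale n x y = tensor2 scale n' x' y'"
    and lin1: "\<And>v. Vector_Spaces.linear scale (*) (\<lambda>u. \<beta> u v)"
    and lin2: "\<And>u. Vector_Spaces.linear scale (*) (\<beta> u)"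
  shows "(\<Sum>i<n. \<beta> (x i) (y i)) = (\<Sum>i<n'. \<beta> (x' i) (y' i))"
proof -
  interpret vector_space "free_scale :: 'k \<Rightarrow> (('a \<times> 'a) \<Rightarrow>\<^sub>0 'k) \<Rightarrow> _"
    by (rule vector_space_free_scale)
  let ?\<phi> = "free_extension (\<lambda>(u, v). \<beta> u v)"
  note lin = linear_free_extension[of "\<lambda>(u, v). \<beta> u v"]
  have "?\<phi> s = 0" if "s \<in> relations2 scale" for s
    using that
    by (auto simp: relations2_def linear_functional_diff[OF lin] linear_functional_scale[OF lin]
        linear_functional_add[OF lin1] linear_functional_scale[OF lin1]
        linear_functional_add[OF lin2] linear_functional_scale[OF lin2])
  moreover have "(\<Sum>i<n. gen (x i, y i)) - (\<Sum>i<n'. gen (x' i, y' i)) \<in> span (relations2 scale)"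
    using eq unfolding tensor2_def coset_eq_iff .
  ultimately have "?\<phi> ((\<Sum>i<n. gen (x i, y i)) - (\<Sum>i<n'. gen (x' i, y' i))) = 0"
    using functional_vanishes_on_span[OF lin] by blast
  then show ?thesis
    by (simp add: linear_functional_diff[OF lin] linear_functional_sum[OF lin])
qed

text \<open>Bilinear forms separate tensors: a functional \<phi> that kills the relations is
  bilinear in the pair labelling a generator, so the hypothesis applies to it, and such functionals
  detect the span of the relations.\<close>

lemma tensor2_eqI:
  fixes scale :: "'k::field \<Rightarrow> 'a::ab_group_add \<Rightarrow> 'a"
  assumes "vector_space scale"
    and eq: "\<And>\<beta>. (\<And>v. Vector_Spaces.linear scale (*) (\<lambda>u. \<beta> u v)) \<Longrightarrow>
      (\<And>u. Vector_Spaces.linear scale (*) (\<beta> u)) \<Longrightarrow>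
      (\<Sum>i<n. \<beta> (x i) (y i)) = (\<Sum>i<n'. \<beta> (x' i) (y' i))"
  shows "tensor2 scale n x y = tensor2 scale n' x' y'"
proof -
  interpret vector_space "free_scale :: 'k \<Rightarrow> (('a \<times> 'a) \<Rightarrow>\<^sub>0 'k) \<Rightarrow> _"
    by (rule vector_space_free_scale)
  have "(\<Sum>i<n. gen (x i, y i)) - (\<Sum>i<n'. gen (x' i, y' i)) \<in> span (relations2 scale)"
  proof (rule in_span_if_functionals_vanish)
    fix \<phi> :: "_ \<Rightarrow> 'k"
    assume lin: "Vector_Spaces.linear free_scale (*) \<phi>"
      and rel: "\<And>s. s \<in> relations2 scale \<Longrightarrow> \<phi> s = 0"
    note diff = linear_functional_diff[OF lin] and scale = linear_functional_scale[OF lin]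
    have "\<phi> (gen (u + u', v)) = \<phi> (gen (u, v)) + \<phi> (gen (u', v))" for u u' v
      using rel[OF relations2_intros(1), unfolded diff] by (simp add: algebra_simps)
    moreover have "\<phi> (gen (u, v + v')) = \<phi> (gen (u, v)) + \<phi> (gen (u, v'))" for u v v'
      using rel[OF relations2_intros(2), unfolded diff] by (simp add: algebra_simps)
    moreover have "\<phi> (gen (scale c u, v)) = c * \<phi> (gen (u, v))" for c u v
      using rel[OF relations2_intros(3), unfolded diff scale] by (simp add: algebra_simps)
    moreover have "\<phi> (gen (u, scale c v)) = c * \<phi> (gen (u, v))" for c u v
      using rel[OF relations2_intros(4), unfolded diff scale] by (simp add: algebra_simps)
    ultimately show "\<phi> ((\<Sum>i<n. gen (x i, y i)) - (\<Sum>i<n'. gen (x' i, y' i))) = 0"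
      using eq[of "\<lambda>u v. \<phi> (gen (u, v))"] assms(1) vector_space_field
      by (simp add: diff linear_functional_sum[OF lin] Vector_Spaces.linear_iff)
  qed
  then show ?thesis
    unfolding tensor2_def coset_eq_iff .
qed

lemma tensor3_eqD:
  fixes scale :: "'k::field \<Rightarrow> 'a::ab_group_add \<Rightarrow> 'a"
  assumes eq: "tensor3 scale n x y z = tensor3 scale n' x' y' z'"
    and lin1: "\<And>v w. Vector_Spaces.linear scale (*) (\<lambda>u. \<beta> u v w)"
    and lin2: "\<And>u w. Vector_Spaces.linear scale (*) (\<lambda>v. \<beta> u v w)"
    and lin3: "\<And>u v. Vector_Spaces.linear scale (*) (\<beta> u v)"
  shows "(\<Sum>i<n. \<beta> (x i) (y i) (z i)) = (\<Sum>i<n'. \<beta> (x' i) (y' i) (z' i))"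
proof -
  interpret vector_space "free_scale :: 'k \<Rightarrow> (('a \<times> 'a \<times> 'a) \<Rightarrow>\<^sub>0 'k) \<Rightarrow> _"
    by (rule vector_space_free_scale)
  let ?\<phi> = "free_extension (\<lambda>(u, v, w). \<beta> u v w)"
  note lin = linear_free_extension[of "\<lambda>(u, v, w). \<beta> u v w"]
  have "?\<phi> s = 0" if "s \<in> relations3 scale" for s
    using that
    by (auto simp: relations3_def linear_functional_diff[OF lin] linear_functional_scale[OF lin]
        linear_functional_add[OF lin1] linear_functional_scale[OF lin1]
        linear_functional_add[OF lin2] linear_functional_scale[OF lin2]
        linear_functional_add[OF lin3] linear_functional_scale[OF lin3])
  moreover have "(\<Sum>i<n. gen (x i, y i, z i)) - (\<Sum>i<n'. gen (x' i, y' i, z' i))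
      \<in> span (relations3 scale)"
    using eq unfolding tensor3_def coset_eq_iff .
  ultimately have "?\<phi> ((\<Sum>i<n. gen (x i, y i, z i)) - (\<Sum>i<n'. gen (x' i, y' i, z' i))) = 0"
    using functional_vanishes_on_span[OF lin] by blast
  then show ?thesis
    by (simp add: linear_functional_diff[OF lin] linear_functional_sum[OF lin])
qed

lemma tensor3_eqI:
  fixes scale :: "'k::field \<Rightarrow> 'a::ab_group_add \<Rightarrow> 'a"
  assumes "vector_space scale"
    and eq: "\<And>\<beta>. (\<And>v w. Vector_Spaces.linear scale (*) (\<lambda>u. \<beta> u v w)) \<Longrightarrow>
      (\<And>u w. Vector_Spaces.linear scale (*) (\<lambda>v. \<beta> u v w)) \<Longrightarrow>
      (\<And>u v. Vector_Spaces.linear scale (*) (\<beta> u v)) \<Longrightarrow>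
      (\<Sum>i<n. \<beta> (x i) (y i) (z i)) = (\<Sum>i<n'. \<beta> (x' i) (y' i) (z' i))"
  shows "tensor3 scale n x y z = tensor3 scale n' x' y' z'"
proof -
  interpret vector_space "free_scale :: 'k \<Rightarrow> (('a \<times> 'a \<times> 'a) \<Rightarrow>\<^sub>0 'k) \<Rightarrow> _"
    by (rule vector_space_free_scale)
  have "(\<Sum>i<n. gen (x i, y i, z i)) - (\<Sum>i<n'. gen (x' i, y' i, z' i)) \<in> span (relations3 scale)"
  proof (rule in_span_if_functionals_vanish)
    fix \<phi> :: "_ \<Rightarrow> 'k"
    assume lin: "Vector_Spaces.linear free_scale (*) \<phi>"
      and rel: "\<And>s. s \<in> relations3 scale \<Longrightarrow> \<phi> s = 0"
    note diff = linear_functional_diff[OF lin] and scale = linear_functional_scale[OF lin]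
    have "\<phi> (gen (u + u', v, w)) = \<phi> (gen (u, v, w)) + \<phi> (gen (u', v, w))" for u u' v w
      using rel[OF relations3_intros(1), unfolded diff] by (simp add: algebra_simps)
    moreover have "\<phi> (gen (u, v + v', w)) = \<phi> (gen (u, v, w)) + \<phi> (gen (u, v', w))" for u v v' w
      using rel[OF relations3_intros(2), unfolded diff] by (simp add: algebra_simps)
    moreover have "\<phi> (gen (u, v, w + w')) = \<phi> (gen (u, v, w)) + \<phi> (gen (u, v, w'))" for u v w w'
      using rel[OF relations3_intros(3), unfolded diff] by (simp add: algebra_simps)
    moreover have "\<phi> (gen (scale c u, v, w)) = c * \<phi> (gen (u, v, w))" for c u v w
      using rel[OF relations3_intros(4), unfolded diff scale] by (simp add: algebra_simps)
    moreover have "\<phi> (gen (u, scale c v, w)) = c * \<phi> (gen (u, v, w))" for c u v w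
      using rel[OF relations3_intros(5), unfolded diff scale] by (simp add: algebra_simps)
    moreover have "\<phi> (gen (u, v, scale c w)) = c * \<phi> (gen (u, v, w))" for c u v w
      using rel[OF relations3_intros(6), unfolded diff scale] by (simp add: algebra_simps)
    ultimately show "\<phi> ((\<Sum>i<n. gen (x i, y i, z i)) - (\<Sum>i<n'. gen (x' i, y' i, z' i))) = 0"
      using eq[of "\<lambda>u v w. \<phi> (gen (u, v, w))"] assms(1) vector_space_field
      by (simp add: diff linear_functional_sum[OF lin] Vector_Spaces.linear_iff)
  qed
  then show ?thesis
    unfolding tensor3_def coset_eq_iff .
qed

section \<open>The dual basis of the trace form\<close>

context symmetric_frobenius_algebra
begin

lemma tau_add: "\<tau> (x + y) = \<tau> x + \<tau> y"
  and tau_scale: "\<tau> (scale c x) = c * \<tau> x"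
  by (rule linear_functional_add[OF linear_form] linear_functional_scale[OF linear_form])+

lemmas tau_sum = linear_functional_sum[OF linear_form]
lemmas tau_diff = linear_functional_diff[OF linear_form]

lemma linear_tau_mult: "Vector_Spaces.linear scale (*) (\<lambda>x. \<tau> (u * x * v))"
  unfolding Vector_Spaces.linear_iff using vector_space_axioms vector_space_field
  by (auto simp: distrib_left distrib_right tau_add tau_scale scale_mult_left scale_mult_right)

lemmas linear_tau_mult_left = linear_tau_mult[where v = 1, simplified]

lemma linear_functional_mult_const:
  assumes "Vector_Spaces.linear scale (*) f"
  shows "Vector_Spaces.linear scale (*) (\<lambda>x. c * f x)"
    and "Vector_Spaces.linear scale (*) (\<lambda>x. f x * c)"
  using assms by (auto simp: Vector_Spaces.linear_iff algebra_simps)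

lemma basis_expansion: "x = (\<Sum>e\<in>B. scale (representation B x e) e)"
  using independent_Basis span_Basis finite_Basis by (simp add: sum_representation_eq)

text \<open>Nondegeneracy in the second argument, applied to \<open>x - y\<close>.\<close>

lemma eq_if_tau_eq:
  assumes "\<And>z. \<tau> (z * x) = \<tau> (z * y)"
  shows "x = y"
proof -
  have "\<tau> (z * (x - y)) = 0" for z
    using assms by (simp add: right_diff_distrib tau_diff)
  then have "x - y = 0"
    using nondegenerate_form unfolding nondegenerate_def by blast
  then show ?thesis
    by simp
qed

lemma eq_if_tau_eq_on_basis:
  assumes "\<And>e. e \<in> B \<Longrightarrow> \<tau> (e * x) = \<tau> (e * y)"
  shows "x = y"
proof (rule eq_if_tau_eq)
  fix z
  have "\<tau> (z * w) = (\<Sum>e\<in>B. representation B z e * \<tau> (e * w))" for w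
    by (subst basis_expansion[of z])
      (simp add: sum_distrib_right scale_mult_left tau_sum tau_scale)
  then show "\<tau> (z * x) = \<tau> (z * y)"
    using assms by simp
qed

text \<open>The map \<open>T\<close> sends \<open>x\<close> to the vector with coordinates
  \<open>\<tau> (e * x)\<close>. Nondegeneracy makes it injective, finite dimension then makes it
  surjective, and a preimage of \<open>e\<close> is the required vector.\<close>

lemma dual_basis_exists:
  assumes "e \<in> B"
  shows "\<exists>d. \<forall>e'\<in>B. \<tau> (e' * d) = (if e' = e then 1 else 0)"
proof -
  define T where "T x = (\<Sum>e\<in>B. scale (\<tau> (e * x)) e)" for x
  have rep: "representation B (T x) e' = \<tau> (e' * x)" if "e' \<in> B" for x e'
    using that independent_Basis span_Basis finite_Basis unfolding T_def
    by (simp add: representation_sum representation_scale representation_basis span_base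
        span_scale if_distrib[of "(*) _"] sum.delta cong: if_cong)
  have "Vector_Spaces.linear scale scale T"
    unfolding Vector_Spaces.linear_iff T_def using vector_space_axioms
    by (auto simp: distrib_left tau_add scale_left_distrib sum.distrib scale_mult_right tau_scale
        scale_sum_right)
  moreover have "inj T"
    by (rule injI, rule eq_if_tau_eq_on_basis) (metis rep)
  ultimately have "surj T"
    by (rule linear_inj_imp_surj)
  then obtain d where "e = T d"
    by blast
  then have "\<tau> (e' * d) = (if e' = e then 1 else 0)" if "e' \<in> B" for e'
    using rep[OF that, of d] assms independent_Basis by (simp add: representation_basis)
  then show ?thesis
    by blast
qed

text \<open>For \<open>e\<close> in \<open>B\<close> the choice is forced, because
  \<open>eq_if_tau_eq_on_basis\<close> shows that the pairings with \<open>B\<close> determine a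
  vector.\<close>

definition dual :: "'a \<Rightarrow> 'a" where
  "dual e = (SOME d. \<forall>e'\<in>B. \<tau> (e' * d) = (if e' = e then 1 else 0))"

lemma tau_basis_dual:
  assumes "e \<in> B" "e' \<in> B"
  shows "\<tau> (e' * dual e) = (if e' = e then 1 else 0)"
  using someI_ex[OF dual_basis_exists[OF assms(1)]] assms(2) unfolding dual_def by blast

lemma dual_expansion: "x = (\<Sum>e\<in>B. scale (\<tau> (e * x)) (dual e))"
proof (rule eq_if_tau_eq_on_basis)
  fix e' assume e': "e' \<in> B"
  have "\<tau> (e' * (\<Sum>e\<in>B. scale (\<tau> (e * x)) (dual e))) = (\<Sum>e\<in>B. \<tau> (e * x) * \<tau> (e' * dual e))"
    by (simp add: sum_distrib_left scale_mult_right tau_sum tau_scale)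
  also have "\<dots> = (\<Sum>e\<in>B. if e' = e then \<tau> (e * x) else 0)"
    using e' by (intro sum.cong) (auto simp: tau_basis_dual)
  finally show "\<tau> (e' * x) = \<tau> (e' * (\<Sum>e\<in>B. scale (\<tau> (e * x)) (dual e)))"
    using e' finite_Basis by simp
qed

text \<open>Pairing the basis expansion of \<open>x\<close> with \<open>dual e\<close> isolates one
  coefficient. This turns traces computed in \<open>B\<close> into expressions in \<tau>.\<close>

lemma representation_eq_tau_dual:
  assumes "e \<in> B"
  shows "representation B x e = \<tau> (x * dual e)"
proof -
  have "\<tau> (x * dual e) = (\<Sum>e'\<in>B. representation B x e' * \<tau> (e' * dual e))"
    by (subst basis_expansion[of x])
      (simp add: sum_distrib_right scale_mult_left tau_sum tau_scale)
  also have "\<dots> = (\<Sum>e'\<in>B. if e' = e then representation B x e' else 0)"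
    using assms by (intro sum.cong) (auto simp: tau_basis_dual)
  finally show ?thesis
    using assms finite_Basis by simp
qed

lemma linear_functional_dual_expansion:
  assumes "Vector_Spaces.linear scale (*) f"
  shows "f x = (\<Sum>e\<in>B. \<tau> (e * x) * f (dual e))"
  using arg_cong[OF dual_expansion[of x], of f]
  by (simp add: linear_functional_sum[OF assms] linear_functional_scale[OF assms])

lemma linear_functional_basis_expansion:
  assumes "Vector_Spaces.linear scale (*) f"
  shows "f x = (\<Sum>e\<in>B. \<tau> (x * dual e) * f e)"
proof -
  have "f x = (\<Sum>e\<in>B. representation B x e * f e)"
    using arg_cong[OF basis_expansion[of x], of f]
    by (simp add: linear_functional_sum[OF assms] linear_functional_scale[OF assms])
  then show ?thesis
    by (simp add: representation_eq_tau_dual)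
qed

text \<open>Inserts the identity operator between \<open>x\<close> and \<open>y\<close>: the
  functional \<open>\<tau> (x * _)\<close> is evaluated on the basis expansion of
  \<open>y\<close>.\<close>

lemma tau_mult_expansion: "\<tau> (x * y) = (\<Sum>e\<in>B. \<tau> (x * e) * \<tau> (dual e * y))"
  using linear_functional_basis_expansion[OF linear_tau_mult_left[of x], of y]
  by (simp add: mult.commute symmetric_form[of y])

text \<open>The diagonal matrix entry at \<open>e\<close> is the \<open>e\<close>-coordinate of
  \<open>a * (e * b)\<close>, which is read off by pairing with \<open>dual e\<close>.\<close>

lemma operator_trace_eq: "operator_trace scale B (L a \<circ> R b) = (\<Sum>e\<in>B. \<tau> (a * e * b * dual e))"
  unfolding operator_trace_def L_def R_def
  by (intro sum.cong) (auto simp: representation_eq_tau_dual mult.assoc)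

section \<open>Tensors are determined by their pairings with the trace form\<close>

text \<open>Expanding both arguments in the dual basis isolates the dependence on \<open>x\<close>
  and \<open>y\<close> in the sums of products of \<tau>-values.\<close>

lemma bilinear_sum_expansion:
  assumes lin1: "\<And>v. Vector_Spaces.linear scale (*) (\<lambda>u. \<beta> u v)"
    and lin2: "\<And>u. Vector_Spaces.linear scale (*) (\<beta> u)"
  shows "(\<Sum>i\<in>I. \<beta> (x i) (y i)) =
    (\<Sum>e\<in>B. \<Sum>f\<in>B. (\<Sum>i\<in>I. \<tau> (e * x i) * \<tau> (f * y i)) * \<beta> (dual e) (dual f))"
proof -
  have "\<beta> u v = (\<Sum>e\<in>B. \<Sum>f\<in>B. \<tau> (e * u) * \<tau> (f * v) * \<beta> (dual e) (dual f))" for u v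
    by (subst linear_functional_dual_expansion[OF lin1],
        subst linear_functional_dual_expansion[OF lin2])
      (simp add: sum_distrib_left mult.assoc)
  then have "(\<Sum>i\<in>I. \<beta> (x i) (y i)) =
      (\<Sum>i\<in>I. \<Sum>e\<in>B. \<Sum>f\<in>B. \<tau> (e * x i) * \<tau> (f * y i) * \<beta> (dual e) (dual f))"
    by (intro sum.cong refl)
  also have "\<dots> = (\<Sum>e\<in>B. \<Sum>i\<in>I. \<Sum>f\<in>B. \<tau> (e * x i) * \<tau> (f * y i) * \<beta> (dual e) (dual f))"
    by (rule sum.swap)
  also have "\<dots> = (\<Sum>e\<in>B. \<Sum>f\<in>B. \<Sum>i\<in>I. \<tau> (e * x i) * \<tau> (f * y i) * \<beta> (dual e) (dual f))"
    by (intro sum.cong refl sum.swap)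
  finally show ?thesis
    by (simp add: sum_distrib_right)
qed

text \<open>The two index sets may have different types, so a presentation indexed by naturals can
  be traded for the sum over \<open>B\<close>.\<close>

lemma bilinear_sum_eqI:
  assumes "\<And>v. Vector_Spaces.linear scale (*) (\<lambda>u. \<beta> u v)"
    and "\<And>u. Vector_Spaces.linear scale (*) (\<beta> u)"
    and "\<And>a b. (\<Sum>i\<in>I. \<tau> (a * x i) * \<tau> (b * y i)) = (\<Sum>j\<in>J. \<tau> (a * x' j) * \<tau> (b * y' j))"
  shows "(\<Sum>i\<in>I. \<beta> (x i) (y i)) = (\<Sum>j\<in>J. \<beta> (x' j) (y' j))"
  by (simp add: bilinear_sum_expansion[OF assms(1,2)] assms(3))

lemma trilinear_sum_expansion:
  assumes lin1: "\<And>v w. Vector_Spaces.linear scale (*) (\<lambda>u. \<beta> u v w)"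
    and lin2: "\<And>u w. Vector_Spaces.linear scale (*) (\<lambda>v. \<beta> u v w)"
    and lin3: "\<And>u v. Vector_Spaces.linear scale (*) (\<beta> u v)"
  shows "(\<Sum>i\<in>I. \<beta> (x i) (y i) (z i)) =
    (\<Sum>e\<in>B. \<Sum>f\<in>B. \<Sum>g\<in>B. (\<Sum>i\<in>I. \<tau> (e * x i) * \<tau> (f * y i) * \<tau> (g * z i)) *
      \<beta> (dual e) (dual f) (dual g))"
proof -
  let ?t = "\<lambda>i e f g. \<tau> (e * x i) * \<tau> (f * y i) * \<tau> (g * z i) * \<beta> (dual e) (dual f) (dual g)"
  have "\<beta> u v w = (\<Sum>e\<in>B. \<Sum>f\<in>B. \<Sum>g\<in>B. \<tau> (e * u) * \<tau> (f * v) * \<tau> (g * w) *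
      \<beta> (dual e) (dual f) (dual g))" for u v w
    by (subst linear_functional_dual_expansion[OF lin1],
        subst linear_functional_dual_expansion[OF lin2],
        subst linear_functional_dual_expansion[OF lin3])
      (simp add: sum_distrib_left mult.assoc)
  then have "(\<Sum>i\<in>I. \<beta> (x i) (y i) (z i)) = (\<Sum>i\<in>I. \<Sum>e\<in>B. \<Sum>f\<in>B. \<Sum>g\<in>B. ?t i e f g)"
    by (intro sum.cong refl)
  also have "\<dots> = (\<Sum>e\<in>B. \<Sum>i\<in>I. \<Sum>f\<in>B. \<Sum>g\<in>B. ?t i e f g)"
    by (rule sum.swap)
  also have "\<dots> = (\<Sum>e\<in>B. \<Sum>f\<in>B. \<Sum>i\<in>I. \<Sum>g\<in>B. ?t i e f g)"
    by (intro sum.cong refl sum.swap)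
  also have "\<dots> = (\<Sum>e\<in>B. \<Sum>f\<in>B. \<Sum>g\<in>B. \<Sum>i\<in>I. ?t i e f g)"
    by (intro sum.cong refl sum.swap)
  finally show ?thesis
    by (simp add: sum_distrib_right)
qed

text \<open>The products \<open>\<tau> (a * u) * \<tau> (b * v)\<close> are themselves bilinear
  forms, and by the dual basis expansion they determine the value of every other one.\<close>

lemma tensor2_eq_iff:
  "tensor2 scale n x y = tensor2 scale n' x' y' \<longleftrightarrow>
    (\<forall>a b. (\<Sum>i<n. \<tau> (a * x i) * \<tau> (b * y i)) = (\<Sum>i<n'. \<tau> (a * x' i) * \<tau> (b * y' i)))"
proof (intro iffI allI)
  fix a b
  assume "tensor2 scale n x y = tensor2 scale n' x' y'"
  then show "(\<Sum>i<n. \<tau> (a * x i) * \<tau> (b * y i)) = (\<Sum>i<n'. \<tau> (a * x' i) * \<tau> (b * y' i))"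
    by (rule tensor2_eqD) (intro linear_functional_mult_const linear_tau_mult_left)+
qed (rule tensor2_eqI[OF vector_space_axioms], rule bilinear_sum_eqI, auto)

lemma tensor3_eq_iff:
  "tensor3 scale n x y z = tensor3 scale n' x' y' z' \<longleftrightarrow>
    (\<forall>a b c. (\<Sum>i<n. \<tau> (a * x i) * \<tau> (b * y i) * \<tau> (c * z i)) =
      (\<Sum>i<n'. \<tau> (a * x' i) * \<tau> (b * y' i) * \<tau> (c * z' i)))"
proof (intro iffI allI)
  fix a b c
  assume "tensor3 scale n x y z = tensor3 scale n' x' y' z'"
  then show "(\<Sum>i<n. \<tau> (a * x i) * \<tau> (b * y i) * \<tau> (c * z i)) =
      (\<Sum>i<n'. \<tau> (a * x' i) * \<tau> (b * y' i) * \<tau> (c * z' i))"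
    by (rule tensor3_eqD) (intro linear_functional_mult_const linear_tau_mult_left)+
qed (rule tensor3_eqI[OF vector_space_axioms], simp add: trilinear_sum_expansion)

section \<open>Characterisation, existence and uniqueness of \<Phi> and \<gamma>\<close>

text \<open>\<open>is_Phi\<close> provides the identity for some presentation only. Its right-hand
  side is trilinear in the tensor factors, so it carries over to every presentation.\<close>

lemma is_Phi_iff:
  "is_Phi scale \<tau> (tensor3 scale n p q r) \<longleftrightarrow>
    (\<forall>a b c. \<tau> (a * b * c) = (\<Sum>k<n. \<tau> (a * p k) * \<tau> (b * q k) * \<tau> (c * r k)))"
proof
  assume "is_Phi scale \<tau> (tensor3 scale n p q r)"
  then obtain n' p' q' r' where eq: "tensor3 scale n p q r = tensor3 scale n' p' q' r'"
    and \<Phi>: "\<And>a b c. \<tau> (a * b * c) = (\<Sum>k<n'. \<tau> (a * p' k) * \<tau> (b * q' k) * \<tau> (c * r' k))"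
    unfolding is_Phi_def by blast
  show "\<forall>a b c. \<tau> (a * b * c) = (\<Sum>k<n. \<tau> (a * p k) * \<tau> (b * q k) * \<tau> (c * r k))"
    by (intro allI) (rule trans[OF \<Phi> eq[unfolded tensor3_eq_iff, rule_format, symmetric]])
qed (auto simp only: is_Phi_def)

text \<open>Symmetry and both reproducing formulas are condensed into one identity: \<gamma> is the
  tensor that represents the form \<open>\<tau> (a * b)\<close>. This has the shape needed for
  \<open>tensor2_eq_iff\<close>.\<close>

lemma is_gamma_iff:
  "is_gamma scale \<tau> (tensor2 scale n g h) \<longleftrightarrow>
    (\<forall>a b. \<tau> (a * b) = (\<Sum>i<n. \<tau> (a * g i) * \<tau> (b * h i)))"
proof
  assume "is_gamma scale \<tau> (tensor2 scale n g h)"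
  then obtain n' g' h' where eq: "tensor2 scale n g h = tensor2 scale n' g' h'"
    and gh: "\<And>a. a = (\<Sum>i<n'. scale (\<tau> (h' i * a)) (g' i))"
    unfolding is_gamma_def by blast
  have "\<tau> (a * b) = (\<Sum>i<n'. \<tau> (a * g' i) * \<tau> (b * h' i))" for a b
  proof -
    have "\<tau> (a * b) = (\<Sum>i<n'. \<tau> (h' i * b) * \<tau> (a * g' i))"
      by (subst gh[of b]) (simp add: sum_distrib_left scale_mult_right tau_sum tau_scale)
    then show ?thesis
      by (simp add: symmetric_form[of b] mult.commute)
  qed
  then show "\<forall>a b. \<tau> (a * b) = (\<Sum>i<n. \<tau> (a * g i) * \<tau> (b * h i))"
    using eq[unfolded tensor2_eq_iff, rule_format, symmetric] by (intro allI) (rule trans)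
next
  assume gh: "\<forall>a b. \<tau> (a * b) = (\<Sum>i<n. \<tau> (a * g i) * \<tau> (b * h i))"
  \<comment> \<open>Exchanging \<open>a\<close> and \<open>b\<close> in the identity exchanges
    \<open>g\<close> and \<open>h\<close>, so symmetry of the tensor is symmetry of the trace
    form.\<close>
  have "tensor2 scale n g h = tensor2 scale n h g"
    unfolding tensor2_eq_iff
  proof (intro allI)
    fix a b
    have "(\<Sum>i<n. \<tau> (a * h i) * \<tau> (b * g i)) = \<tau> (b * a)"
      by (subst mult.commute) (rule gh[rule_format, symmetric])
    then show "(\<Sum>i<n. \<tau> (a * g i) * \<tau> (b * h i)) = (\<Sum>i<n. \<tau> (a * h i) * \<tau> (b * g i))"
      using gh[rule_format, of a b] symmetric_form[of a b] by (simp only:)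
  qed
  moreover have "a = (\<Sum>i<n. scale (\<tau> (h i * a)) (g i))" for a
  proof (rule eq_if_tau_eq)
    fix z
    show "\<tau> (z * a) = \<tau> (z * (\<Sum>i<n. scale (\<tau> (h i * a)) (g i)))"
      using gh[rule_format, of z a]
      by (simp add: sum_distrib_left scale_mult_right tau_sum tau_scale
          symmetric_form[of a] mult.commute)
  qed
  moreover have "a = (\<Sum>i<n. scale (\<tau> (a * g i)) (h i))" for a
  proof (rule eq_if_tau_eq)
    fix z
    show "\<tau> (z * a) = \<tau> (z * (\<Sum>i<n. scale (\<tau> (a * g i)) (h i)))"
      using gh[rule_format, of a z] symmetric_form[of z a]
      by (simp add: sum_distrib_left scale_mult_right tau_sum tau_scale)
  qed
  ultimately show "is_gamma scale \<tau> (tensor2 scale n g h)"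
    unfolding is_gamma_def by blast
qed

text \<open>Expanding first \<open>b\<close> and then \<open>c\<close> in the basis exhibits \<Phi>
  as the sum of the tensors \<open>e * f\<close> \<otimes> \<open>dual e\<close> \<otimes>
  \<open>dual f\<close>.\<close>

lemma tau_mult_mult_expansion:
  "\<tau> (a * b * c) = (\<Sum>(e, f)\<in>B \<times> B. \<tau> (a * (e * f)) * \<tau> (b * dual e) * \<tau> (c * dual f))"
proof -
  have "\<tau> (a * b * c) = (\<Sum>e\<in>B. \<tau> (b * dual e) * \<tau> (a * e * c))"
    by (rule linear_functional_basis_expansion[OF linear_tau_mult])
  also have "\<dots> = (\<Sum>e\<in>B. \<tau> (b * dual e) * (\<Sum>f\<in>B. \<tau> (c * dual f) * \<tau> (a * e * f)))"
    by (subst linear_functional_basis_expansion[OF linear_tau_mult_left]) simp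
  finally show ?thesis
    by (simp add: sum.cartesian_product[symmetric] sum_distrib_left mult.assoc mult.commute
        mult.left_commute)
qed

lemma ex1_Phi: "\<exists>!\<Phi>. is_Phi scale \<tau> \<Phi>"
proof (rule ex_ex1I)
  \<comment> \<open>Presentations are indexed by initial segments of the naturals, so the pairs of
    basis vectors have to be enumerated.\<close>
  obtain s where s: "bij_betw s {..<card (B \<times> B)} (B \<times> B)"
    using ex_bij_betw_nat_finite[of "B \<times> B"] finite_Basis
    by (auto simp: atLeast0LessThan)
  have "is_Phi scale \<tau> (tensor3 scale (card (B \<times> B))
      (\<lambda>k. fst (s k) * snd (s k)) (\<lambda>k. dual (fst (s k))) (\<lambda>k. dual (snd (s k))))"
    unfolding is_Phi_iff tau_mult_mult_expansion sum.reindex_bij_betw[OF s, symmetric]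
    by (simp add: case_prod_unfold)
  then show "\<exists>\<Phi>. is_Phi scale \<tau> \<Phi>" ..
next
  fix \<Phi> \<Phi>'
  assume *: "is_Phi scale \<tau> \<Phi>" "is_Phi scale \<tau> \<Phi>'"
  then obtain n p q r n' p' q' r'
    where \<Phi>: "\<Phi> = tensor3 scale n p q r" "\<Phi>' = tensor3 scale n' p' q' r'"
    unfolding is_Phi_def by blast
  show "\<Phi> = \<Phi>'"
    unfolding \<Phi> tensor3_eq_iff
    \<comment> \<open>The pairings of both tensors with \<open>a\<close>, \<open>b\<close>,
      \<open>c\<close> equal \<open>\<tau> (a * b * c)\<close>.\<close>
    by (intro allI) (rule trans[OF *(1)[unfolded \<Phi> is_Phi_iff, rule_format, symmetric]
          *(2)[unfolded \<Phi> is_Phi_iff, rule_format]])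
qed

lemma tau_mult_dual_expansion: "\<tau> (a * b) = (\<Sum>e\<in>B. \<tau> (a * e) * \<tau> (b * dual e))"
  by (simp only: tau_mult_expansion[of a b] symmetric_form[of "dual _" b])

lemma ex1_gamma: "\<exists>!\<gamma>. is_gamma scale \<tau> \<gamma>"
proof (rule ex_ex1I)
  obtain s where s: "bij_betw s {..<card B} B"
    using ex_bij_betw_nat_finite[OF finite_Basis] by (auto simp: atLeast0LessThan)
  have "is_gamma scale \<tau> (tensor2 scale (card B) s (\<lambda>i. dual (s i)))"
    unfolding is_gamma_iff
    by (intro allI) (rule trans[OF tau_mult_dual_expansion sum.reindex_bij_betw[OF s, symmetric]])
  then show "\<exists>\<gamma>. is_gamma scale \<tau> \<gamma>" ..
next
  fix \<gamma> \<gamma>'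
  assume *: "is_gamma scale \<tau> \<gamma>" "is_gamma scale \<tau> \<gamma>'"
  then obtain n g h n' g' h'
    where \<gamma>: "\<gamma> = tensor2 scale n g h" "\<gamma>' = tensor2 scale n' g' h'"
    unfolding is_gamma_def by blast
  show "\<gamma> = \<gamma>'"
    unfolding \<gamma> tensor2_eq_iff
    by (intro allI) (rule trans[OF *(1)[unfolded \<gamma> is_gamma_iff, rule_format, symmetric]
          *(2)[unfolded \<gamma> is_gamma_iff, rule_format]])
qed

section \<open>The trace of left and right multiplication\<close>

lemma linear_tau_mult2:
  "Vector_Spaces.linear scale (*) (\<lambda>u. \<tau> (a * u * b * v))"
  "Vector_Spaces.linear scale (*) (\<lambda>v. \<tau> (a * u * b * v))"
  using linear_tau_mult[of a "b * v"] linear_tau_mult_left[of "a * u * b"]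
  by (simp_all add: mult.assoc)

text \<open>The basis together with its dual basis also presents \<gamma>, and the left-hand side is
  a bilinear expression in \<gamma>; evaluated on that presentation it is the trace formula.\<close>

lemma gamma_sum_eq_trace:
  assumes "is_gamma scale \<tau> (tensor2 scale n g h)"
  shows "(\<Sum>i<n. \<tau> (a * g i * b * h i)) = operator_trace scale B (L a \<circ> R b)"
  unfolding operator_trace_eq
proof (rule bilinear_sum_eqI[where \<beta> = "\<lambda>u v. \<tau> (a * u * b * v)", OF linear_tau_mult2])
  fix u v
  show "(\<Sum>i<n. \<tau> (u * g i) * \<tau> (v * h i)) = (\<Sum>e\<in>B. \<tau> (u * e) * \<tau> (v * dual e))"
    using assms[unfolded is_gamma_iff, rule_format, symmetric] tau_mult_dual_expansion
    by (rule trans)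
qed

lemma Phi_sum_eq_trace:
  assumes "is_Phi scale \<tau> (tensor3 scale n p q r)"
  shows "(\<Sum>k<n. \<Sum>l<n. \<tau> (a * p k) * \<tau> (b * p l) * \<tau> (q k * q l) * \<tau> (r k * r l)) =
    operator_trace scale B (L a \<circ> R b)"
proof -
  note \<Phi> = assms[unfolded is_Phi_iff, rule_format]
  \<comment> \<open>Brings the sums over the two copies of \<Phi> innermost, where they can be
    evaluated for fixed \<open>e\<close> and \<open>f\<close>.\<close>
  have sum4: "(\<Sum>k<n. \<Sum>l<n. \<Sum>e\<in>B. \<Sum>f\<in>B. F k l e f) = (\<Sum>e\<in>B. \<Sum>f\<in>B. \<Sum>k<n. \<Sum>l<n. F k l e f)"
    for F :: "nat \<Rightarrow> nat \<Rightarrow> 'a \<Rightarrow> 'a \<Rightarrow> 'k"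
  proof -
    have "(\<Sum>k<n. \<Sum>l<n. \<Sum>e\<in>B. \<Sum>f\<in>B. F k l e f) = (\<Sum>k<n. \<Sum>e\<in>B. \<Sum>f\<in>B. \<Sum>l<n. F k l e f)"
      by (rule sum.cong[OF refl], subst sum.swap) (intro sum.cong refl sum.swap)
    also have "\<dots> = (\<Sum>e\<in>B. \<Sum>f\<in>B. \<Sum>k<n. \<Sum>l<n. F k l e f)"
      by (subst sum.swap) (intro sum.cong refl sum.swap)
    finally show ?thesis .
  qed
  have tau: "\<tau> (x * y) = (\<Sum>e\<in>B. \<tau> (e * x) * \<tau> (dual e * y))" for x y
    by (subst tau_mult_expansion) (simp only: symmetric_form[of x])
  have "(\<Sum>k<n. \<Sum>l<n. \<tau> (a * p k) * \<tau> (b * p l) * \<tau> (q k * q l) * \<tau> (r k * r l)) =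
      (\<Sum>k<n. \<Sum>l<n. \<Sum>e\<in>B. \<Sum>f\<in>B. (\<tau> (a * p k) * \<tau> (e * q k) * \<tau> (f * r k)) *
        (\<tau> (b * p l) * \<tau> (dual e * q l) * \<tau> (dual f * r l)))"
  \<comment> \<open>Expanding the two mixed factors decouples the copies of \<Phi>: \<open>k\<close>
    now meets only \<open>a\<close>, \<open>e\<close>, \<open>f\<close>, and \<open>l\<close> only
    \<open>b\<close>, \<open>dual e\<close>, \<open>dual f\<close>.\<close>
  proof (intro sum.cong refl)
    fix k l
    let ?c = "\<tau> (a * p k) * \<tau> (b * p l)"
    have "?c * \<tau> (q k * q l) * \<tau> (r k * r l) =
        ?c * (\<Sum>e\<in>B. \<tau> (e * q k) * \<tau> (dual e * q l)) * (\<Sum>f\<in>B. \<tau> (f * r k) * \<tau> (dual f * r l))"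
      by (simp only: tau[of "q k" "q l"] tau[of "r k" "r l"])
    also have "\<dots> = (\<Sum>e\<in>B. \<Sum>f\<in>B.
        (?c * (\<tau> (e * q k) * \<tau> (dual e * q l))) * (\<tau> (f * r k) * \<tau> (dual f * r l)))"
      by (simp only: sum_distrib_left[of ?c] sum_product)
    finally show "?c * \<tau> (q k * q l) * \<tau> (r k * r l) =
        (\<Sum>e\<in>B. \<Sum>f\<in>B. (\<tau> (a * p k) * \<tau> (e * q k) * \<tau> (f * r k)) *
          (\<tau> (b * p l) * \<tau> (dual e * q l) * \<tau> (dual f * r l)))"
      by (simp only: ac_simps)
  qed
  \<comment> \<open>The double sum over \<open>k\<close> and \<open>l\<close> is a product, and each
    factor is an instance of the defining identity of \<Phi>.\<close>
  also have "\<dots> = (\<Sum>e\<in>B. \<Sum>f\<in>B. \<tau> (a * e * f) * \<tau> (b * dual e * dual f))"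
    by (simp only: sum4 sum_product[symmetric] \<Phi>[symmetric])
  \<comment> \<open>The sum over \<open>f\<close> is the expansion of the trace form at
    \<open>a * e\<close> and \<open>b * dual e\<close>.\<close>
  also have "\<dots> = (\<Sum>e\<in>B. \<tau> (a * e * (b * dual e)))"
    by (intro sum.cong refl tau_mult_dual_expansion[symmetric])
  finally show ?thesis
    unfolding operator_trace_eq by (simp add: mult.assoc)
qed

section \<open>Invariance under commutators\<close>

text \<open>A factor moves from the left of \<open>e\<close> to the right of \<open>dual e\<close>:
  paired with \<open>a\<close> and \<open>b\<close>, both tensors give
  \<open>\<tau> (a * x * b)\<close>.\<close>

lemma casimir_left:
  assumes "\<And>v. Vector_Spaces.linear scale (*) (\<lambda>u. \<beta> u v)"
    and "\<And>u. Vector_Spaces.linear scale (*) (\<beta> u)"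
  shows "(\<Sum>e\<in>B. \<beta> (x * e) (dual e)) = (\<Sum>e\<in>B. \<beta> e (dual e * x))"
proof (rule bilinear_sum_eqI[OF assms])
  fix a b
  have "\<tau> (b * (dual e * x)) = \<tau> (x * b * dual e)" for e
    using symmetric_form[of "b * dual e" x] by (simp add: mult.assoc)
  then show "(\<Sum>e\<in>B. \<tau> (a * (x * e)) * \<tau> (b * dual e)) =
      (\<Sum>e\<in>B. \<tau> (a * e) * \<tau> (b * (dual e * x)))"
    using tau_mult_dual_expansion[of "a * x" b] tau_mult_dual_expansion[of a "x * b"]
    by (simp add: mult.assoc)
qed

text \<open>A factor moves from the right of \<open>e\<close> to the left of \<open>dual e\<close>:
  the pairings are \<open>\<tau> (x * a * b)\<close> and \<open>\<tau> (a * b * x)\<close>, equal by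
  cyclicity.\<close>

lemma casimir_right:
  assumes "\<And>v. Vector_Spaces.linear scale (*) (\<lambda>u. \<beta> u v)"
    and "\<And>u. Vector_Spaces.linear scale (*) (\<beta> u)"
  shows "(\<Sum>e\<in>B. \<beta> (e * x) (dual e)) = (\<Sum>e\<in>B. \<beta> e (x * dual e))"
proof (rule bilinear_sum_eqI[OF assms])
  fix a b
  have "\<tau> (a * (e * x)) = \<tau> (x * a * e)" for e
    using symmetric_form[of "a * e" x] by (simp add: mult.assoc)
  moreover have "\<tau> (x * a * b) = \<tau> (a * (b * x))"
    using symmetric_form[of x "a * b"] by (simp add: mult.assoc)
  ultimately show "(\<Sum>e\<in>B. \<tau> (a * (e * x)) * \<tau> (b * dual e)) =
      (\<Sum>e\<in>B. \<tau> (a * e) * \<tau> (b * (x * dual e)))"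
    using tau_mult_dual_expansion[of "x * a" b] tau_mult_dual_expansion[of a "b * x"]
    by (simp add: mult.assoc)
qed

lemma linear_trace:
  "Vector_Spaces.linear scale (*) (\<lambda>a. operator_trace scale B (L a \<circ> R b))"
  "Vector_Spaces.linear scale (*) (\<lambda>b. operator_trace scale B (L a \<circ> R b))"
  unfolding operator_trace_eq Vector_Spaces.linear_iff
  using vector_space_axioms vector_space_field
  by (auto simp: distrib_left distrib_right tau_add tau_scale scale_mult_left scale_mult_right
      sum.distrib sum_distrib_left)

text \<open>Cyclicity of \<tau> carries \<open>x\<close> from the front to behind
  \<open>dual e\<close>, and \<open>casimir_left\<close> carries it on to the front of
  \<open>e\<close>, just after \<open>y\<close>.\<close>

lemma trace_left_commute:
  "operator_trace scale B (L (x * y) \<circ> R b) = operator_trace scale B (L (y * x) \<circ> R b)"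
proof -
  have "\<tau> (x * y * e * b * dual e) = \<tau> (y * e * b * (dual e * x))" for e
    using symmetric_form[of x "y * e * b * dual e"] by (simp add: mult.assoc)
  then have "(\<Sum>e\<in>B. \<tau> (x * y * e * b * dual e)) = (\<Sum>e\<in>B. \<tau> (y * (x * e) * b * dual e))"
    using casimir_left[of "\<lambda>u v. \<tau> (y * u * b * v)", OF linear_tau_mult2] by simp
  then show ?thesis
    by (simp add: operator_trace_eq mult.assoc)
qed

text \<open>Here \<open>casimir_right\<close> alone suffices: \<open>x\<close> passes from between
  \<open>e\<close> and \<open>y\<close> to between \<open>y\<close> and
  \<open>dual e\<close>.\<close>

lemma trace_right_commute:
  "operator_trace scale B (L a \<circ> R (x * y)) = operator_trace scale B (L a \<circ> R (y * x))"
  using casimir_right[of "\<lambda>u v. \<tau> (a * u * y * v)" x, OF linear_tau_mult2]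
  by (simp add: operator_trace_eq mult.assoc)

lemma functional_HH0_class_eq:
  assumes "Vector_Spaces.linear scale (*) f" "\<And>x y. f (x * y) = f (y * x)"
    and "a' \<in> HH0_class scale (*) a"
  shows "f a' = f a"
proof -
  have "f (a' - a) = 0"
  proof (rule functional_vanishes_on_span[OF assms(1)])
    show "a' - a \<in> span {x * y - y * x | x y :: 'a. True}"
      using assms(3) unfolding HH0_class_def commutator_space_def by simp
  next
    fix s :: 'a
    assume "s \<in> {x * y - y * x | x y. True}"
    then obtain x y where "s = x * y - y * x"
      by blast
    then show "f s = 0"
      using assms(2)[of x y] by (simp add: linear_functional_diff[OF assms(1)])
  qed
  then show ?thesis
    by (simp add: linear_functional_diff[OF assms(1)])
qed

text \<open>The arguments are replaced one at a time. This makes the trace well defined on classes,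
  as the use of \<open>the_elem\<close> in the pairings requires.\<close>

lemma trace_HH0_class_eq:
  assumes "a' \<in> HH0_class scale (*) a" "b' \<in> HH0_class scale (*) b"
  shows "operator_trace scale B (L a' \<circ> R b') = operator_trace scale B (L a \<circ> R b)"
  by (rule trans[OF functional_HH0_class_eq[OF linear_trace(1) trace_left_commute assms(1)]
        functional_HH0_class_eq[OF linear_trace(2) trace_right_commute assms(2)]])

section \<open>Classes in \<open>HH_0\<close> and the values of the pairings on them\<close>

lemma mem_HH0_class: "a \<in> HH0_class scale m a"
  by (simp add: HH0_class_def commutator_space_def span_zero)

lemma HH0_class_eq:
  assumes "x \<in> HH0_class scale m a"
  shows "HH0_class scale m x = HH0_class scale m a"
  using assms unfolding HH0_class_def commutator_space_def coset_eq_iff by simp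

text \<open>Commutators of the opposite algebra are those of the algebra with \<open>x\<close> and
  \<open>y\<close> interchanged.\<close>

lemma HH0_class_op_mult: "HH0_class scale op_mult = HH0_class scale (*)"
proof -
  have "{op_mult x y - op_mult y x | x y. True} = {x * y - y * x | x y :: 'a. True}"
    unfolding op_mult_def by blast
  then show ?thesis
    unfolding HH0_class_def commutator_space_def by presburger
qed

lemma the_elem_eqI:
  assumes "x \<in> X" "\<And>y. y \<in> X \<Longrightarrow> y = x"
  shows "the_elem X = x"
proof -
  have "X = {x}"
    using assms by blast
  then show ?thesis
    by simp
qed

lemma vee_HH0_class: "vee scale (HH0_class scale (*) b) = HH0_class scale (*) b"
  unfolding vee_def HH0_class_op_mult id_apply
proof (rule the_elem_eqI, goal_cases)
  case 1
  show ?case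
    unfolding mem_Collect_eq by (intro exI conjI) (rule refl mem_HH0_class)+
next
  case (2 y)
  then show ?case
    unfolding mem_Collect_eq by (elim exE conjE) (simp only: HH0_class_eq)
qed

lemma HH0_pairing_eq:
  "HH0_pairing scale B (HH0_class scale (*) a) (HH0_class scale (*) b) =
    operator_trace scale B (L a \<circ> R b)"
  unfolding HH0_pairing_def
proof (rule the_elem_eqI, goal_cases)
  case 1
  show ?case
    unfolding mem_Collect_eq by (intro exI conjI) (rule refl mem_HH0_class)+
next
  case (2 y)
  then show ?case
    unfolding mem_Collect_eq by (elim exE conjE) (simp only: trace_HH0_class_eq)
qed

lemma TFT_pairing_eq:
  "TFT_pairing scale \<tau> (HH0_class scale (*) a) (HH0_class scale (*) b) =
    operator_trace scale B (L a \<circ> R b)"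
proof -
  \<comment> \<open>Existence of \<Phi> makes the set of values nonempty; a presentation of it is
    the witness for membership of the trace.\<close>
  obtain \<Phi>' where "is_Phi scale \<tau> \<Phi>'"
    using ex1_Phi by (elim ex1E)
  moreover from this obtain n p q r where "\<Phi>' = tensor3 scale n p q r"
    unfolding is_Phi_def by blast
  ultimately have \<Phi>: "is_Phi scale \<tau> (tensor3 scale n p q r)"
    by (simp only:)
  show ?thesis
    unfolding TFT_pairing_def
  proof (rule the_elem_eqI, goal_cases)
    case 1
    show ?case
      unfolding mem_Collect_eq
      by (intro exI conjI) (rule Phi_sum_eq_trace[OF \<Phi>, symmetric] \<Phi> mem_HH0_class)+
  next
    case (2 y)
    \<comment> \<open>An arbitrary presentation and arbitrary representatives:
      \<open>Phi_sum_eq_trace\<close> removes the dependence on the former, invariance under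
      commutators that on the latter.\<close>
    then obtain n p q r a' b' where "is_Phi scale \<tau> (tensor3 scale n p q r)"
      and ab: "a' \<in> HH0_class scale (*) a" "b' \<in> HH0_class scale (*) b"
      and y: "y = (\<Sum>k<n. \<Sum>l<n. \<tau> (a' * p k) * \<tau> (b' * p l) * \<tau> (q k * q l) * \<tau> (r k * r l))"
      unfolding mem_Collect_eq by (elim exE conjE)
    then have "y = operator_trace scale B (L a' \<circ> R b')"
      by (simp only: Phi_sum_eq_trace)
    then show ?case
      using trace_HH0_class_eq[OF ab] by simp
  qed
qed

end

theorem mainTheorem6:
  fixes scale :: "'k::field \<Rightarrow> 'a::{ring, monoid_mult} \<Rightarrow> 'a"
    and B :: "'a set"
    and \<tau> :: "'a \<Rightarrow> 'k"
  assumes "symmetric_frobenius_algebra scale B \<tau>"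
  shows "(\<exists>!\<Phi>. is_Phi scale \<tau> \<Phi>) \<and>
    (\<exists>!\<gamma>. is_gamma scale \<tau> \<gamma>) \<and>
    (\<forall>a b.
      TFT_pairing scale \<tau> (HH0_class scale (*) a) (HH0_class scale (*) b) =
        HH0_pairing scale B (HH0_class scale (*) a) (vee scale (HH0_class scale (*) b)) \<and>
      HH0_pairing scale B (HH0_class scale (*) a) (vee scale (HH0_class scale (*) b)) =
        operator_trace scale B (L a \<circ> R b) \<and>
      (\<forall>n p q r. is_Phi scale \<tau> (tensor3 scale n p q r) \<longrightarrow>
        (\<Sum>k<n. \<Sum>l<n. \<tau> (a * p k) * \<tau> (b * p l) * \<tau> (q k * q l) * \<tau> (r k * r l)) =
          operator_trace scale B (L a \<circ> R b)) \<and>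
      (\<forall>n g h. is_gamma scale \<tau> (tensor2 scale n g h) \<longrightarrow>
        (\<Sum>i<n. \<tau> (a * g i * b * h i)) = operator_trace scale B (L a \<circ> R b)))"
proof (intro conjI allI impI)
  note pairings = symmetric_frobenius_algebra.vee_HH0_class[OF assms]
    symmetric_frobenius_algebra.HH0_pairing_eq[OF assms]
    symmetric_frobenius_algebra.TFT_pairing_eq[OF assms]
  fix a b
  show "TFT_pairing scale \<tau> (HH0_class scale (*) a) (HH0_class scale (*) b) =
      HH0_pairing scale B (HH0_class scale (*) a) (vee scale (HH0_class scale (*) b))"
    \<comment> \<open>The map \<open>vee\<close> fixes the class of \<open>b\<close>, after which
      both pairings become the same trace.\<close>
    by (simp only: pairings)
  show "HH0_pairing scale B (HH0_class scale (*) a) (vee scale (HH0_class scale (*) b)) =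
      operator_trace scale B (L a \<circ> R b)"
    by (simp only: pairings)
next
  fix a b n p q r
  assume "is_Phi scale \<tau> (tensor3 scale n p q r)"
  then show "(\<Sum>k<n. \<Sum>l<n. \<tau> (a * p k) * \<tau> (b * p l) * \<tau> (q k * q l) * \<tau> (r k * r l)) =
      operator_trace scale B (L a \<circ> R b)"
    by (rule symmetric_frobenius_algebra.Phi_sum_eq_trace[OF assms])
next
  fix a b n g h
  assume "is_gamma scale \<tau> (tensor2 scale n g h)"
  then show "(\<Sum>i<n. \<tau> (a * g i * b * h i)) = operator_trace scale B (L a \<circ> R b)"
    by (rule symmetric_frobenius_algebra.gamma_sum_eq_trace[OF assms])
qed (rule symmetric_frobenius_algebra.ex1_Phi[OF assms]
    symmetric_frobenius_algebra.ex1_gamma[OF assms])+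

end
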